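(* Let $\Pi$ be a Gibbs partition with parameters $(\alpha,V)$, let $n,m\ge1$, and condition on the restriction of $\Pi$ to $[n]$ being a given partition into $j$ blocks with sizes $(n_1,\dots,n_j)$. For $l=1,\dots,m$ let $W^{(n)}_{l,m}$ be the (conditional) number of new blocks of size $l$ generated by the integers $n+1,\dots,n+m$. For all nonnegative integers $r_1,\dots,r_m$ with $m-\sum_l l r_l\ge0$, $$\mathbb{E}\Big[\prod_{l=1}^m(W^{(n)}_{l,m})_{[r_l]}\Big]=\frac{m!\,\prod_{l=1}^m[(1-\alpha)_{l-1}]^{r_l}}{(m-\sum_l l r_l)!\,\prod_{l=1}^m(l!)^{r_l}}\,\frac1{V_{n,j}}\sum_{k-\sum_l r_l=0}^{m-\sum_l l r_l}V_{n+m,j+k}\,S^{-1,-\alpha,-(n-j\alpha)}_{m-\sum_l l r_l,\;k-\sum_l r_l}.$$ In particular, for every $l\in\{1,\dots,m\}$ and every nonnegative integer $r\le\lfloor m/l\rfloor$, $$\mathbb{E}\big[(W^{(n)}_{l,m})_{[r]}\big]=\frac{m!}{(m-rl)!}\,\frac{[(1-\alpha)_{l-1}]^r}{(l!)^r}\,\frac1{V_{n,j}}\sum_{k-r=0}^{m-rl}V_{n+m,j+k}\,S^{-1,-\alpha,-(n-j\alpha)}_{m-rl,\,k-r}.$$ (Expectations are conditional on the given partition of $[n]$.)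
   Context: Notation: $(x)_n=x(x+1)\cdots(x+n-1)$ ($(x)_0=1$); $(x)_{[n]}=x(x-1)\cdots(x-n+1)$ ($(x)_{[0]}=1$); $\sum_{k-a=0}^{M}$ means $k$ ranges over $a,\dots,a+M$. Gibbs partition with parameters $(\alpha,V)$: $\alpha\in(-\infty,1)$ and $V=(V_{n,k})_{1\le k\le n}$ are nonnegative weights with $V_{1,1}=1$ and $V_{n,k}=(n-k\alpha)V_{n+1,k}+V_{n+1,k+1}$; $\Pi$ is the exchangeable random partition of the positive integers such that for every $n$ and every partition $\{A_1,\dots,A_k\}$ of $[n]=\{1,\dots,n\}$, the restriction $\Pi_n$ of $\Pi$ to $[n]$ satisfies $\mathbb{P}(\Pi_n=\{A_1,\dots,A_k\})=V_{n,k}\prod_{i=1}^k(1-\alpha)_{|A_i|-1}$. Conditional setting: it is assumed $V_{n,j}>0$. Given $\Pi_n$ (with $j$ blocks of sizes $n_1,\dots,n_j$), a block of $\Pi_{n+m}$ is old if it meets $[n]$, new otherwise. The conditional probability that $\Pi_{n+m}$ equals a specified partition extending $\Pi_n$, in which the old blocks gain $m_1,\dots,m_j\ge0$ elements and there are $k$ new blocks of sizes $s_1,\dots,s_k\ge1$, is $\frac{V_{n+m,j+k}}{V_{n,j}}\prod_{i=1}^j(n_i-\alpha)_{m_i}\prod_{i=1}^k(1-\alpha)_{s_i-1}$. Generalized central Stirling numbers: $S^{-1,-\alpha}_{n,k}=\frac{n!}{k!}\sum_{(n_1,\dots,n_k)}\prod_{j=1}^k\frac{(1-\alpha)_{n_j-1}}{n_j!}$,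 the sum being over compositions of $n$ into $k$ positive parts ($S_{0,0}^{-1,-\alpha}=1$, $S_{n,0}^{-1,-\alpha}=0$ for $n\ge1$, $S_{n,k}^{-1,-\alpha}=0$ for $k>n$). Generalized non-central Stirling numbers: $S^{-1,-\alpha,\gamma}_{n,k}=\sum_{s=k}^n\binom ns S^{-1,-\alpha}_{s,k}(-\gamma)_{n-s}$. *)

theory Defs
  imports "HOL-Probability.Probability" "HOL-Library.Disjoint_Sets"
    "HOL-Combinatorics.Permutations"
begin

definition falling :: "real \<Rightarrow> nat \<Rightarrow> real" where
  "falling x n = (\<Prod>i<n. x - real i)"

definition restrict_partition :: "nat set set \<Rightarrow> nat set \<Rightarrow> nat set set" where
  "restrict_partition Q A = (\<lambda>B. B \<inter> A) ` Q - {{}}"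

definition restriction_event ::
  "'w measure \<Rightarrow> ('w \<Rightarrow> nat set set) \<Rightarrow> nat \<Rightarrow> nat set set \<Rightarrow> 'w set" where
  "restriction_event M X n P =
     {\<omega> \<in> space M. restrict_partition (X \<omega>) {1..n} = P}"

text \<open>
  A random partition of the positive integers. Measurability refers to the sigma-algebra
  on partitions generated by the restrictions to the sets \<open>{1..n}\<close>.
\<close>

locale random_partition = prob_space M for M :: "'w measure" +
  fixes X :: "'w \<Rightarrow> nat set set"
  assumes partition: "\<omega> \<in> space M \<Longrightarrow> partition_on {1..} (X \<omega>)"
    and measurable_restriction:
      "partition_on {1..n} P \<Longrightarrow> restriction_event M X n P \<in> sets M"

locale exchangeable_partition = random_partition +
  assumes exchangeable:
    "\<lbrakk>partition_on {1..n} P; \<sigma> permutes {1..n}\<rbrakk> \<Longrightarrow>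
       prob (restriction_event M X n ((\<lambda>A. \<sigma> ` A) ` P)) = prob (restriction_event M X n P)"

text \<open>Values \<open>V n k\<close> outside \<open>1 \<le> k \<le> n\<close> are irrelevant.\<close>

locale gibbs_weights =
  fixes \<alpha> :: real and V :: "nat \<Rightarrow> nat \<Rightarrow> real"
  assumes alpha_less_1: "\<alpha> < 1"
    and V_nonneg: "\<lbrakk>1 \<le> k; k \<le> n\<rbrakk> \<Longrightarrow> 0 \<le> V n k"
    and V_1_1: "V 1 1 = 1"
    and V_rec: "\<lbrakk>1 \<le> k; k \<le> n\<rbrakk> \<Longrightarrow>
      V n k = (real n - real k * \<alpha>) * V (n + 1) k + V (n + 1) (k + 1)"

locale gibbs_partition = exchangeable_partition M X + gibbs_weights \<alpha> V
  for M :: "'w measure" and X :: "'w \<Rightarrow> nat set set"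
    and \<alpha> :: real and V :: "nat \<Rightarrow> nat \<Rightarrow> real" +
  assumes prob_restriction: "\<lbrakk>1 \<le> n; partition_on {1..n} P\<rbrakk> \<Longrightarrow>
    prob (restriction_event M X n P) =
      V n (card P) * (\<Prod>A\<in>P. pochhammer (1 - \<alpha>) (card A - 1))"

definition new_blocks :: "('w \<Rightarrow> nat set set) \<Rightarrow> nat \<Rightarrow> nat \<Rightarrow> nat \<Rightarrow> 'w \<Rightarrow> nat" where
  "new_blocks X n m l \<omega> =
     card {B \<in> restrict_partition (X \<omega>) {1..n + m}. B \<inter> {1..n} = {} \<and> card B = l}"

text \<open>For an event \<open>E\<close> of positive probability, \<open>uniform_measure M E\<close> is the conditional
  probability measure given \<open>E\<close>.\<close>

definition cond_expectation :: "'w measure \<Rightarrow> 'w set \<Rightarrow> ('w \<Rightarrow> real) \<Rightarrow> real" where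
  "cond_expectation M E f = integral\<^sup>L (uniform_measure M E) f"

definition compositions :: "nat \<Rightarrow> nat \<Rightarrow> nat list set" where
  "compositions n k = {ns. length ns = k \<and> (\<forall>x\<in>set ns. 1 \<le> x) \<and> sum_list ns = n}"

text \<open>
  The generalized central Stirling numbers with superscript \<open>(-1, -\<alpha>)\<close>. The boundary values
  need no separate clauses: \<open>compositions 0 0 = {[]}\<close>, and \<open>compositions n k\<close> is empty for
  \<open>k > n\<close> and for \<open>k = 0 < n\<close>.
\<close>

definition gen_stirling :: "real \<Rightarrow> nat \<Rightarrow> nat \<Rightarrow> real" where
  "gen_stirling \<alpha> n k = fact n / fact k *
     (\<Sum>ns\<in>compositions n k. \<Prod>i<k. pochhammer (1 - \<alpha>) (ns ! i - 1) / fact (ns ! i))"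

text \<open>The generalized non-central Stirling numbers with superscript \<open>(-1, -\<alpha>, \<gamma>)\<close>.\<close>

definition gen_stirling_nc :: "real \<Rightarrow> real \<Rightarrow> nat \<Rightarrow> nat \<Rightarrow> real" where
  "gen_stirling_nc \<alpha> \<gamma> n k =
     (\<Sum>s=k..n. real (n choose s) * gen_stirling \<alpha> s k * pochhammer (- \<gamma>) (n - s))"

end

theory Submission
  imports Defs "HOL-Computational_Algebra.Formal_Power_Series"
begin

text \<open>
  The conditional expectation is a finite sum over the partitions \<open>Q\<close> of \<open>{1..n+m}\<close> that restrict
  to \<open>P\<close>. The falling factorials count ordered selections of distinct new blocks of prescribed
  sizes; removing one selected block \<open>B\<close> of size \<open>l\<close> leaves a partition extending \<open>P\<close> on
  \<open>l\<close> fewer elements, at the cost of a factor \<open>(1 - \<alpha>)\<^bsub>l-1\<^esub>\<close> and one block, with \<open>m choose l\<close> choices of \<open>B\<close>.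
  This reduces to the case \<open>r = 0\<close>. There, inserting elements one by one shows that the weighted number
  of extensions with \<open>k\<close> new blocks satisfies
  \<open>S(m + 1, k) = S(m, k - 1) + (m - k \<alpha> + n - j \<alpha>) S(m, k)\<close>. The non-central Stirling numbers
  satisfy the same recurrence because their generating function is \<open>f\<^sup>k g / k!\<close>, where
  \<open>(1 - x) f' = 1 - \<alpha> f\<close> and \<open>(1 - x) g' = (n - j \<alpha>) g\<close>.
\<close>

section \<open>Exponential generating functions and the recurrence of the Stirling numbers\<close>

text \<open>The exponential generating function of the weights of a single block:
  \<open>(1 - (1 - x)^\<alpha>) / \<alpha>\<close>, or \<open>- log (1 - x)\<close> if
  \<open>\<alpha> = 0\<close>. The index 0 is set apart because \<open>s - 1\<close> truncates there
  and would produce a nonzero constant term.\<close>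

definition block_fps :: "real \<Rightarrow> real fps" where
  "block_fps \<alpha> = Abs_fps (\<lambda>s. if s = 0 then 0 else pochhammer (1 - \<alpha>) (s - 1) / fact s)"

text \<open>The binomial series \<open>(1 - x)^(- c)\<close>.\<close>

definition rising_fps :: "real \<Rightarrow> real fps" where
  "rising_fps c = Abs_fps (\<lambda>s. pochhammer c s / fact s)"

text \<open>The coefficient of a power is a sum over all lists of naturals with the right length and
  sum. Lists with a zero entry drop out because the constant term of \<open>f\<close>
  vanishes.\<close>

lemma fps_power_nth_compositions:
  fixes f :: "real fps"
  assumes "fps_nth f 0 = 0"
  shows "fps_nth (f ^ k) n = (\<Sum>ns\<in>compositions n k. \<Prod>i<k. fps_nth f (ns ! i))"
proof (cases k)
  case 0
  have "compositions n 0 = (if n = 0 then {[]} else {})"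
    by (auto simp: compositions_def)
  then show ?thesis using 0 by simp
next
  case (Suc p)
  have "(\<Sum>ns\<in>natpermute n k. \<Prod>i<k. fps_nth f (ns ! i)) =
        (\<Sum>ns\<in>compositions n k. \<Prod>i<k. fps_nth f (ns ! i))"
  proof (rule sum.mono_neutral_right)
    show "finite (natpermute n k)" by (rule natpermute_finite)
    show "compositions n k \<subseteq> natpermute n k"
      by (auto simp: compositions_def natpermute_def)
    show "\<forall>ns\<in>natpermute n k - compositions n k. (\<Prod>i<k. fps_nth f (ns ! i)) = 0"
    proof
      fix ns assume ns: "ns \<in> natpermute n k - compositions n k"
      then obtain i where "i < k" "ns ! i = 0"
        by (auto simp: natpermute_def compositions_def in_set_conv_nth not_le)
      then show "(\<Prod>i<k. fps_nth f (ns ! i)) = 0" using assms by force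
    qed
  qed
  then show ?thesis
    using Suc by (simp add: fps_power_nth atLeast0AtMost lessThan_Suc_atMost del: power_Suc)
qed

text \<open>The parts of a composition are positive, so the exceptional coefficient of
  \<open>block_fps \<alpha>\<close> at 0 never occurs.\<close>

lemma gen_stirling_eq_fps_nth:
  "gen_stirling \<alpha> n k = fact n / fact k * fps_nth (block_fps \<alpha> ^ k) n"
proof -
  have "(\<Prod>i<k. fps_nth (block_fps \<alpha>) (ns ! i)) =
        (\<Prod>i<k. pochhammer (1 - \<alpha>) (ns ! i - 1) / fact (ns ! i))"
    if "ns \<in> compositions n k" for ns
  proof (rule prod.cong)
    fix i assume "i \<in> {..<k}"
    then have "ns ! i \<noteq> 0" using that by (force simp: compositions_def in_set_conv_nth)
    then show "fps_nth (block_fps \<alpha>) (ns ! i) =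
      pochhammer (1 - \<alpha>) (ns ! i - 1) / fact (ns ! i)"
      by (simp add: block_fps_def)
  qed simp
  then show ?thesis
    by (simp add: gen_stirling_def fps_power_nth_compositions block_fps_def)
qed

lemma gen_stirling_eq_0: "n < k \<Longrightarrow> gen_stirling \<alpha> n k = 0"
  unfolding gen_stirling_eq_fps_nth
  using startsby_zero_power_prefix[of "block_fps \<alpha>" k] by (simp add: block_fps_def)

lemma gen_stirling_nc_eq_0: "n < k \<Longrightarrow> gen_stirling_nc \<alpha> \<gamma> n k = 0"
  by (simp add: gen_stirling_nc_def)

text \<open>The defining sum is a binomial convolution, hence a product of exponential generating
  functions; terms with \<open>s < k\<close> may be added since they vanish. The parameter is
  negated so that the definition yields rising factorials of \<open>c\<close>.\<close>

lemma gen_stirling_nc_eq_fps_nth: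
  "gen_stirling_nc \<alpha> (- c) n k =
     fact n / fact k * fps_nth (block_fps \<alpha> ^ k * rising_fps c) n"
proof -
  have "gen_stirling_nc \<alpha> (- c) n k =
      (\<Sum>s=0..n. real (n choose s) * gen_stirling \<alpha> s k * pochhammer c (n - s))"
    unfolding gen_stirling_nc_def minus_minus
    by (rule sum.mono_neutral_left) (auto simp: gen_stirling_eq_0)
  also have "\<dots> = (\<Sum>s=0..n. fact n / fact k *
      (fps_nth (block_fps \<alpha> ^ k) s * fps_nth (rising_fps c) (n - s)))"
    by (rule sum.cong)
       (simp_all add: gen_stirling_eq_fps_nth rising_fps_def binomial_fact field_simps)
  finally show ?thesis by (simp add: fps_mult_nth sum_distrib_left)
qed

text \<open>Serves in both directions: to verify differential equations coefficientwise, and to read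
  a recurrence off one.\<close>

lemma nth_one_minus_X_mult_deriv:
  fixes h :: "real fps"
  shows "fps_nth ((1 - fps_X) * fps_deriv h) n =
     real (Suc n) * fps_nth h (Suc n) - real n * fps_nth h n"
  by (cases n) (simp_all add: left_diff_distrib)

lemma Suc_mult_divide_fact: "real (Suc n) * (x / fact (Suc n)) = x / fact n"
  by (simp del: of_nat_Suc)

text \<open>The coefficient of index \<open>p + 1\<close> rests on
  \<open>(1 - \<alpha> + p) - (p + 1) = - \<alpha>\<close>; the coefficient of index 0 accounts for
  the summand 1.\<close>

lemma block_fps_ode:
  "(1 - fps_X) * fps_deriv (block_fps \<alpha>) = 1 - fps_const \<alpha> * block_fps \<alpha>"
proof (rule fps_ext)
  fix n
  show "fps_nth ((1 - fps_X) * fps_deriv (block_fps \<alpha>)) n =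
        fps_nth (1 - fps_const \<alpha> * block_fps \<alpha>) n"
  proof (cases n)
    case (Suc p)
    have "fps_nth ((1 - fps_X) * fps_deriv (block_fps \<alpha>)) n =
        pochhammer (1 - \<alpha>) (Suc p) / fact (Suc p)
        - real (Suc p) * (pochhammer (1 - \<alpha>) p / fact (Suc p))"
      unfolding nth_one_minus_X_mult_deriv Suc
      using Suc_mult_divide_fact[of "Suc p"] by (simp add: block_fps_def del: fact_Suc of_nat_Suc)
    then show ?thesis
      by (simp add: Suc block_fps_def pochhammer_Suc field_simps del: fact_Suc)
  qed (simp add: block_fps_def nth_one_minus_X_mult_deriv)
qed

lemma rising_fps_ode: "(1 - fps_X) * fps_deriv (rising_fps c) = fps_const c * rising_fps c"
proof (rule fps_ext)
  fix n
  have "fps_nth ((1 - fps_X) * fps_deriv (rising_fps c)) n =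
      pochhammer c (Suc n) / fact n - real n * (pochhammer c n / fact n)"
    unfolding nth_one_minus_X_mult_deriv rising_fps_def fps_nth_Abs_fps
    by (simp only: Suc_mult_divide_fact)
  then show "fps_nth ((1 - fps_X) * fps_deriv (rising_fps c)) n =
      fps_nth (fps_const c * rising_fps c) n"
    by (simp add: rising_fps_def pochhammer_Suc field_simps)
qed

text \<open>The product rule and the two differential equations give
  \<open>(1 - x) h_k' = k h_(k-1) + (c - k \<alpha>) h_k\<close> for \<open>h_k = f^k g\<close>. The
  recurrence compares coefficients of \<open>x^n\<close>.\<close>

lemma gen_stirling_nc_Suc:
  "gen_stirling_nc \<alpha> (- c) (Suc n) k =
     (if k = 0 then 0 else gen_stirling_nc \<alpha> (- c) n (k - 1)) +
     (real n - real k * \<alpha> + c) * gen_stirling_nc \<alpha> (- c) n k"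
proof -
  let ?f = "block_fps \<alpha>" and ?g = "rising_fps c"
  let ?h = "\<lambda>k. ?f ^ k * ?g"
  have "(1 - fps_X) * fps_deriv (?h k) =
      fps_const (real k) * ((1 - fps_X) * fps_deriv ?f) * ?f ^ (k - 1) * ?g
      + ?f ^ k * ((1 - fps_X) * fps_deriv ?g)"
    by (simp add: fps_deriv_power algebra_simps)
  also have "\<dots> = fps_const (real k) * ?h (k - 1)
      - fps_const (real k) * (fps_const \<alpha> * (?f * ?f ^ (k - 1) * ?g)) + fps_const c * ?h k"
    unfolding block_fps_ode rising_fps_ode by (simp add: algebra_simps)
  \<comment> \<open>For \<open>k = 0\<close> the truncated exponent breaks
    \<open>f f^(k-1) = f^k\<close>, but then the factor \<open>k\<close> makes both sides
    zero.\<close>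
  also have "fps_const (real k) * (fps_const \<alpha> * (?f * ?f ^ (k - 1) * ?g)) =
      fps_const (real k * \<alpha>) * ?h k"
    by (cases k) (simp_all add: mult.assoc flip: fps_const_mult)
  finally have *: "(1 - fps_X) * fps_deriv (?h k) = fps_const (real k) * ?h (k - 1)
      - fps_const (real k * \<alpha>) * ?h k + fps_const c * ?h k" .
  have "real (Suc n) * fps_nth (?h k) (Suc n) =
      real k * fps_nth (?h (k - 1)) n + (real n - real k * \<alpha> + c) * fps_nth (?h k) n"
    using nth_one_minus_X_mult_deriv[of "?h k" n] unfolding *
    by (simp add: mult.assoc ring_distribs)
  moreover have "gen_stirling_nc \<alpha> (- c) (Suc n) k =
      fact n / fact k * (real (Suc n) * fps_nth (?h k) (Suc n))"
    by (simp add: gen_stirling_nc_eq_fps_nth)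
  ultimately have "gen_stirling_nc \<alpha> (- c) (Suc n) k =
      fact n / fact k * (real k * fps_nth (?h (k - 1)) n)
      + (real n - real k * \<alpha> + c) * gen_stirling_nc \<alpha> (- c) n k"
    by (simp only: gen_stirling_nc_eq_fps_nth distrib_left mult.left_commute)
  moreover have "fact n / fact k * (real k * fps_nth (?h (k - 1)) n) =
      (if k = 0 then 0 else gen_stirling_nc \<alpha> (- c) n (k - 1))"
    by (cases k) (simp_all add: gen_stirling_nc_eq_fps_nth del: of_nat_Suc)
  ultimately show ?thesis by simp
qed

section \<open>Set partitions extending a given partition\<close>

text \<open>\<open>U\<close> holds the elements added to the ground set \<open>N\<close>. It is an
  arbitrary set and not an interval because deleting a block leaves an arbitrary subset of
  it.\<close>

definition extensions :: "nat set \<Rightarrow> nat set set \<Rightarrow> nat set \<Rightarrow> nat set set set" where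
  "extensions N P U = {Q. partition_on (N \<union> U) Q \<and> restrict_partition Q N = P}"

definition block_weight :: "real \<Rightarrow> nat set set \<Rightarrow> real" where
  "block_weight \<alpha> Q = (\<Prod>A\<in>Q. pochhammer (1 - \<alpha>) (card A - 1))"

lemma restrict_partition_self: "partition_on N Q \<Longrightarrow> restrict_partition Q N = Q"
proof -
  assume Q: "partition_on N Q"
  then have "(\<lambda>B. B \<inter> N) ` Q = id ` Q"
    by (intro image_cong) (auto dest: partition_onD1)
  then show ?thesis
    using partition_onD3[OF Q] by (simp add: restrict_partition_def)
qed

lemma restrict_partition_remove_empty:
  "restrict_partition (Q - {{}}) N = restrict_partition Q N"
  unfolding restrict_partition_def by auto

lemma restrict_partition_restrict_partition:
  "A \<subseteq> B \<Longrightarrow> restrict_partition (restrict_partition Q B) A = restrict_partition Q A"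
proof -
  assume "A \<subseteq> B"
  then have "B \<inter> A = A" by auto
  then have "(\<lambda>C. C \<inter> A) ` (\<lambda>C. C \<inter> B) ` Q = (\<lambda>C. C \<inter> A) ` Q"
    by (simp add: image_image Int_assoc)
  then show ?thesis
    using restrict_partition_remove_empty[of "(\<lambda>C. C \<inter> B) ` Q" A]
    by (simp add: restrict_partition_def)
qed

lemma partition_on_restrict_partition:
  "partition_on C Q \<Longrightarrow> A \<subseteq> C \<Longrightarrow> partition_on A (restrict_partition Q A)"
  using partition_on_restrict[of C Q A]
  by (simp add: restrict_partition_def Int_absorb2 Int_commute)

lemma restrict_partition_insert_disjoint:
  "B \<inter> N = {} \<Longrightarrow> restrict_partition (insert B Q) N = restrict_partition Q N"
  by (auto simp: restrict_partition_def)

lemma restrict_partition_insert_element: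
  "x \<notin> N \<Longrightarrow> restrict_partition (insert (insert x A) Q) N = restrict_partition (insert A Q) N"
  by (simp add: restrict_partition_def)

lemma extensions_empty: "partition_on N P \<Longrightarrow> extensions N P {} = {P}"
  by (auto simp: extensions_def restrict_partition_self)

lemma finite_extensions: "finite N \<Longrightarrow> finite U \<Longrightarrow> finite (extensions N P U)"
  unfolding extensions_def
  by (rule finite_subset[OF _ finitely_many_partition_on[of "N \<union> U"]]) auto

lemma finite_extension:
  "\<lbrakk>finite N; finite U; Q \<in> extensions N P U\<rbrakk> \<Longrightarrow> finite Q"
  unfolding extensions_def using finite_elements[of "N \<union> U" Q] by auto

section \<open>Removing a new block and inserting an element\<close>

text \<open>A block disjoint from \<open>N\<close> leaves no trace on \<open>N\<close>. The conjunct
  \<open>B \<notin> Q\<close> lets \<open>Q\<close> be recovered from \<open>insert B Q\<close>, so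
  for fixed \<open>B\<close> this describes a bijection.\<close>

lemma extensions_insert_block:
  assumes "B \<noteq> {}" "B \<subseteq> U" "N \<inter> U = {}"
  shows "insert B Q \<in> extensions N P U \<and> B \<notin> Q \<longleftrightarrow> Q \<in> extensions N P (U - B)"
proof -
  have N: "B \<inter> N = {}" "N \<union> U - B = N \<union> (U - B)" using assms by auto
  have "partition_on (N \<union> U) (insert B Q) \<longleftrightarrow> partition_on (N \<union> (U - B)) Q" if "disjnt B (\<Union>Q)"
    using partition_on_insert[OF that, of "N \<union> U"] assms N by auto
  moreover have "disjnt B (\<Union>Q)" if "partition_on (N \<union> U) (insert B Q)" "B \<notin> Q"
    using partition_onD2[OF that(1)] that(2) by (auto simp: disjoint_def disjnt_def)
  moreover have "disjnt B (\<Union>Q)" if "partition_on (N \<union> (U - B)) Q"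
    using partition_onD1[OF that] N by (auto simp: disjnt_def)
  moreover have "B \<notin> Q" if "partition_on (N \<union> (U - B)) Q"
    using partition_onD1[OF that] N assms by auto
  ultimately show ?thesis
    using restrict_partition_insert_disjoint[OF N(1), of Q] unfolding extensions_def by auto
qed

text \<open>Double counting of extensions with one marked new block of size \<open>l\<close>: either
  the extension is chosen first, or the block. Since \<open>1 \<le> l\<close>, the marked block is
  nonempty.\<close>

lemma sum_extensions_new_blocks:
  fixes h :: "nat set set \<Rightarrow> nat set \<Rightarrow> 'b::comm_monoid_add"
  assumes "finite N" "finite U" "N \<inter> U = {}" "1 \<le> l"
  shows "(\<Sum>Q\<in>extensions N P U. \<Sum>B\<in>{B \<in> Q. B \<inter> N = {} \<and> card B = l}. h Q B) =
    (\<Sum>B\<in>{B. B \<subseteq> U \<and> card B = l}. \<Sum>Q\<in>extensions N P (U - B). h (insert B Q) B)"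
proof -
  have "(\<Sum>Q\<in>extensions N P U. \<Sum>B\<in>{B \<in> Q. B \<inter> N = {} \<and> card B = l}. h Q B) =
     (\<Sum>(Q, B)\<in>Sigma (extensions N P U) (\<lambda>Q. {B \<in> Q. B \<inter> N = {} \<and> card B = l}). h Q B)"
    using assms by (intro sum.Sigma) (auto simp: finite_extensions finite_extension)
  also have "\<dots> = (\<Sum>(B, Q)\<in>Sigma {B. B \<subseteq> U \<and> card B = l} (\<lambda>B. extensions N P (U - B)).
      h (insert B Q) B)"
  proof (rule sum.reindex_bij_witness[where i = "\<lambda>(B, Q). (insert B Q, B)"
        and j = "\<lambda>(Q, B). (B, Q - {B})"], goal_cases)
    case (2 x)
    then obtain Q B where x: "x = (Q, B)" "Q \<in> extensions N P U" "B \<in> Q" "B \<inter> N = {}" "card B = l"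
      by auto
    then have "B \<subseteq> U" "B \<noteq> {}"
      using assms by (auto simp: extensions_def dest!: partition_onD1)
    then show ?case
      using x extensions_insert_block[of B U N "Q - {B}" P] assms by (auto simp: insert_absorb)
  next
    case (4 y)
    then obtain Q B where x: "y = (B, Q)" "Q \<in> extensions N P (U - B)" "B \<subseteq> U" "card B = l"
      by auto
    moreover have "B \<noteq> {}" using x assms by auto
    ultimately show ?case
      using extensions_insert_block[of B U N Q P] assms by auto
  next
    case (3 y)
    then obtain Q B where x: "y = (B, Q)" "Q \<in> extensions N P (U - B)" "B \<subseteq> U" "card B = l"
      by auto
    moreover have "B \<noteq> {}" using x assms by auto
    ultimately show ?case
      using extensions_insert_block[of B U N Q P] assms by auto
  qed (auto simp: insert_absorb)
  also have "\<dots> = (\<Sum>B\<in>{B. B \<subseteq> U \<and> card B = l}. \<Sum>Q\<in>extensions N P (U - B). h (insert B Q) B)"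
    using assms by (intro sum.Sigma[symmetric]) (auto simp: finite_extensions)
  finally show ?thesis .
qed

text \<open>The pair \<open>(Q, {})\<close> encodes adding \<open>x\<close> as a singleton block.\<close>

definition add_to_block :: "nat \<Rightarrow> nat set set \<times> nat set \<Rightarrow> nat set set" where
  "add_to_block x = (\<lambda>(Q, A). insert (insert x A) (Q - {A}))"

text \<open>The block containing \<open>x\<close> reveals \<open>A\<close>, and the blocks avoiding
  \<open>x\<close> reveal \<open>Q - {A}\<close>. Since \<open>{} \<notin> Q\<close>, these two
  determine \<open>Q\<close>.\<close>

lemma inj_on_add_to_block:
  assumes "x \<notin> N \<union> U"
  shows "inj_on (add_to_block x) (Sigma (extensions N P U) (insert {}))"
proof (rule inj_onI, clarify)
  fix Q A R B
  assume Q: "Q \<in> extensions N P U" "A \<in> insert {} Q"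
    and R: "R \<in> extensions N P U" "B \<in> insert {} R"
    and eq: "add_to_block x (Q, A) = add_to_block x (R, B)"
  have x: "x \<notin> C" if "C \<in> insert {} Q \<union> insert {} R" for C
    using that Q R assms by (auto simp: extensions_def dest!: partition_onD1)
  have "{C \<in> add_to_block x (Q, A). x \<in> C} = {insert x A}"
    "{C \<in> add_to_block x (R, B). x \<in> C} = {insert x B}"
    using x by (auto simp: add_to_block_def)
  then have "insert x A = insert x B" using eq by auto
  then have AB: "A = B" using x Q R by (metis UnI1 UnI2 insert_ident)
  have "{C \<in> add_to_block x (Q, A). x \<notin> C} = Q - {A}"
    "{C \<in> add_to_block x (R, B). x \<notin> C} = R - {A}"
    using x AB by (auto simp: add_to_block_def)
  then have "Q - {A} = R - {A}" using eq by auto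
  moreover have "{} \<notin> Q" "{} \<notin> R" using Q R by (auto simp: extensions_def partition_on_def)
  ultimately have "Q = R" using Q R AB by (cases "A = {}") auto
  then show "Q = R \<and> A = B" using AB by simp
qed

lemma image_add_to_block:
  assumes "x \<notin> N \<union> U"
  shows "add_to_block x ` Sigma (extensions N P U) (insert {}) = extensions N P (insert x U)"
proof (intro equalityI subsetI)
  fix R assume "R \<in> add_to_block x ` Sigma (extensions N P U) (insert {})"
  then obtain Q A where Q: "partition_on (N \<union> U) Q" "restrict_partition Q N = P" "A \<in> insert {} Q"
    and R: "R = insert (insert x A) (Q - {A})"
    by (auto simp: add_to_block_def extensions_def)
  have x: "x \<notin> C" if "C \<in> Q" for C
    using that Q assms by (auto dest!: partition_onD1)
  have d: "disjoint Q" "{} \<notin> Q" "\<Union>Q = N \<union> U" using Q by (auto simp: partition_on_def)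
  have AD: "A \<inter> D = {}" if "D \<in> Q - {A}" for D
    using d(1) Q(3) that by (auto simp: disjoint_def)
  have "partition_on (N \<union> insert x U) R"
  proof (rule partition_onI)
    have "\<Union>R = insert x (\<Union>(insert A (Q - {A})))"
      unfolding R by (simp only: Union_insert Un_insert_left)
    also have "insert A (Q - {A}) = insert A Q" by simp
    also have "insert x (\<Union>(insert A Q)) = insert x (N \<union> U)" using d(3) Q(3) by auto
    finally show "\<Union>R = N \<union> insert x U" by simp
    show "disjnt p q" if "p \<in> R" "q \<in> R" "p \<noteq> q" for p q
    proof -
      have "disjnt (insert x A) D" "disjnt D (insert x A)" if "D \<in> Q - {A}" for D
        using AD[OF that] x that by (auto simp: disjnt_def)
      moreover have "disjnt D E" if "D \<in> Q" "E \<in> Q" "D \<noteq> E" for D E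
        using d(1) that by (simp add: disjoint_def disjnt_def)
      ultimately show ?thesis using that unfolding R by blast
    qed
    show "{} \<notin> R" using d unfolding R by auto
  qed
  \<comment> \<open>\<open>x\<close> is invisible on \<open>N\<close>, so the enlarged block has the
    trace of \<open>A\<close>, which is a block of \<open>Q\<close> or empty.\<close>
  moreover have "restrict_partition R N = restrict_partition (insert A Q) N"
    using assms unfolding R by (simp add: restrict_partition_insert_element)
  then have "restrict_partition R N = P"
    using Q(2,3) restrict_partition_insert_disjoint[of "{}" N Q] by (auto simp: insert_absorb)
  ultimately show "R \<in> extensions N P (insert x U)" by (simp add: extensions_def)
next
  fix R assume R: "R \<in> extensions N P (insert x U)"
  then have d: "disjoint R" "{} \<notin> R" "\<Union>R = N \<union> insert x U" and P: "restrict_partition R N = P"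
    by (auto simp: extensions_def partition_on_def)
  then obtain C where C: "C \<in> R" "x \<in> C" by auto
  have CD: "D \<inter> C = {}" if "D \<in> R" "D \<noteq> C" for D
    using d(1) C(1) that by (auto simp: disjoint_def)
  \<comment> \<open>The preimage deletes \<open>x\<close> from its block. If that block is
    \<open>{x}\<close>, then \<open>A\<close> is empty and has to be dropped from
    \<open>Q\<close>.\<close>
  define A where "A = C - {x}"
  define Q where "Q = insert A (R - {C}) - {{}}"
  have xA: "x \<notin> A" "insert x A = C" using C by (auto simp: A_def)
  \<comment> \<open>Otherwise taking \<open>A\<close> out of \<open>Q\<close> would lose a block of
    \<open>R\<close>.\<close>
  have "A \<notin> R - {C}"
  proof
    assume A: "A \<in> R - {C}"
    then have "A \<inter> C = {}" using CD[of A] by auto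
    then have "A = {}" by (auto simp: A_def)
    then show False using A d(2) by auto
  qed
  then have "add_to_block x (Q, A) = R" 
    using xA C(1) d(2) by (auto simp: add_to_block_def Q_def)
  moreover have "A \<in> insert {} Q" by (auto simp: Q_def)
  moreover have "partition_on (N \<union> U) Q"
  proof (rule partition_onI)
    show "\<Union>Q = N \<union> U"
    proof -
      have "\<Union>Q = A \<union> \<Union>(R - {C})" unfolding Q_def by auto
      moreover have "x \<notin> \<Union>(R - {C})" using CD C(2) by auto
      moreover have "\<Union>R = C \<union> \<Union>(R - {C})" using C(1) by auto
      ultimately have "\<Union>Q = \<Union>R - {x}" by (auto simp: A_def)
      then show ?thesis using d(3) assms by auto
    qed
    show "disjnt p q" if "p \<in> Q" "q \<in> Q" "p \<noteq> q" for p q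
    proof -
      have "disjnt A D" "disjnt D A" if "D \<in> R - {C}" for D
        using CD[of D] that by (auto simp: A_def disjnt_def)
      moreover have "disjnt D E" if "D \<in> R" "E \<in> R" "D \<noteq> E" for D E
        using d(1) that by (simp add: disjoint_def disjnt_def)
      ultimately show ?thesis using that unfolding Q_def by blast
    qed
    show "{} \<notin> Q" unfolding Q_def by auto
  qed
  moreover have "restrict_partition Q N = P"
  proof -
    have "restrict_partition Q N = restrict_partition (insert C (R - {C})) N"
      using assms restrict_partition_insert_element[of x N A "R - {C}"]
      unfolding Q_def restrict_partition_remove_empty xA(2) by auto
    then show ?thesis using P C(1) by (simp add: insert_absorb)
  qed
  ultimately show "R \<in> add_to_block x ` Sigma (extensions N P U) (insert {})"
    unfolding extensions_def by (intro image_eqI[of _ _ "(Q, A)"]) auto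
qed

lemma sum_extensions_insert:
  fixes h :: "nat set set \<Rightarrow> 'b::comm_monoid_add"
  assumes "finite N" "finite U" "x \<notin> N \<union> U"
  shows "(\<Sum>Q\<in>extensions N P (insert x U). h Q) =
     (\<Sum>Q\<in>extensions N P U. \<Sum>A\<in>insert {} Q. h (insert (insert x A) (Q - {A})))"
proof -
  have "(\<Sum>Q\<in>extensions N P (insert x U). h Q) =
      (\<Sum>(Q, A)\<in>Sigma (extensions N P U) (insert {}). h (insert (insert x A) (Q - {A})))"
    unfolding image_add_to_block[OF assms(3), symmetric]
    by (subst sum.reindex[OF inj_on_add_to_block[OF assms(3)]])
       (simp add: add_to_block_def case_prod_unfold)
  also have "\<dots> = (\<Sum>Q\<in>extensions N P U. \<Sum>A\<in>insert {} Q. h (insert (insert x A) (Q - {A})))"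
    using assms by (intro sum.Sigma[symmetric]) (auto simp: finite_extensions finite_extension)
  finally show ?thesis .
qed

lemma falling_0 [simp]: "falling x 0 = 1"
  by (simp add: falling_def)

text \<open>The first factor is split off, not the last: after one block is selected, the others are
  selected from one fewer.\<close>

lemma falling_Suc: "falling x (Suc r) = x * falling (x - 1) r"
  unfolding falling_def by (subst prod.lessThan_Suc_shift) (simp add: algebra_simps)

section \<open>Weighted enumeration of extensions\<close>

lemma block_weight_insert:
  "finite Q \<Longrightarrow> A \<notin> Q \<Longrightarrow>
     block_weight \<alpha> (insert A Q) = pochhammer (1 - \<alpha>) (card A - 1) * block_weight \<alpha> Q"
  by (simp add: block_weight_def)

text \<open>Joining a block \<open>A\<close> multiplies the weight by
  \<open>card A - \<alpha>\<close> and keeps the number of blocks; a new singleton has weight 1 and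
  adds a block. The block sizes sum to \<open>card G\<close>.\<close>

lemma sum_block_weight_add_element:
  fixes z :: "nat \<Rightarrow> real"
  assumes G: "finite G" "partition_on G Q" and x: "x \<notin> G"
  shows "(\<Sum>A\<in>insert {} Q. z (card (insert (insert x A) (Q - {A}))) *
        block_weight \<alpha> (insert (insert x A) (Q - {A}))) =
     block_weight \<alpha> Q * (z (Suc (card Q)) + (real (card G) - real (card Q) * \<alpha>) * z (card Q))"
proof -
  have fin: "finite Q" using G by (rule finite_elements)
  have ne: "{} \<notin> Q" using G by (simp add: partition_on_def)
  have xA: "insert x A \<notin> Q" for A using x G by (auto dest!: partition_onD1)
  have finA: "finite A" "x \<notin> A" "A \<noteq> {}" if "A \<in> Q" for A
    using that x G ne by (auto dest!: partition_onD1 intro: finite_subset)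
  have "z (card (insert (insert x A) (Q - {A}))) * block_weight \<alpha> (insert (insert x A) (Q - {A})) =
      (real (card A) - \<alpha>) * (block_weight \<alpha> Q * z (card Q))" if A: "A \<in> Q" for A
  proof -
    have "card (insert (insert x A) (Q - {A})) = card Q"
      using fin xA card_Suc_Diff1[OF fin A] by simp
    moreover obtain a where a: "card A = Suc a"
      using finA[OF A] by (metis card_0_eq not0_implies_Suc)
    have "block_weight \<alpha> Q = pochhammer (1 - \<alpha>) a * block_weight \<alpha> (Q - {A})"
      using block_weight_insert[of "Q - {A}" A \<alpha>] fin A a by (simp add: insert_absorb)
    moreover have "block_weight \<alpha> (insert (insert x A) (Q - {A})) =
        pochhammer (1 - \<alpha>) (Suc a) * block_weight \<alpha> (Q - {A})"
      using block_weight_insert[of "Q - {A}" "insert x A" \<alpha>] fin xA finA[OF A] a by simp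
    ultimately show ?thesis by (simp add: a pochhammer_Suc diff_add_eq mult_ac add_ac)
  qed
  then have "(\<Sum>A\<in>Q. z (card (insert (insert x A) (Q - {A}))) *
        block_weight \<alpha> (insert (insert x A) (Q - {A}))) =
      (\<Sum>A\<in>Q. real (card A) - \<alpha>) * (block_weight \<alpha> Q * z (card Q))"
    by (simp add: sum_distrib_right)
  also have "(\<Sum>A\<in>Q. real (card A) - \<alpha>) = real (card G) - real (card Q) * \<alpha>"
  proof -
    have "card G = (\<Sum>A\<in>Q. card A)"
      using G finA(1) card_Union_disjoint[of Q] by (simp add: partition_on_def)
    then show ?thesis by (simp add: sum_subtractf)
  qed
  finally show ?thesis
    using fin ne xA[of "{}"] block_weight_insert[of Q "{x}" \<alpha>] by (simp add: algebra_simps)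
qed

lemma gen_stirling_nc_0_0: "gen_stirling_nc \<alpha> \<gamma> 0 0 = 1"
  using gen_stirling_nc_eq_fps_nth[of \<alpha> "- \<gamma>" 0 0] by (simp add: rising_fps_def)

text \<open>The recurrence moved from the Stirling numbers onto the weight \<open>z\<close> by an
  index shift; the boundary terms at \<open>k = 0\<close> and \<open>k = Suc m\<close>
  vanish.\<close>

lemma gen_stirling_nc_sum_Suc:
  fixes z :: "nat \<Rightarrow> real"
  shows "(\<Sum>k\<le>m. (z (Suc k) + (real m - real k * \<alpha> + c) * z k) * gen_stirling_nc \<alpha> (- c) m k) =
     (\<Sum>k\<le>Suc m. z k * gen_stirling_nc \<alpha> (- c) (Suc m) k)"
proof -
  have "(\<Sum>k\<le>Suc m. z k * gen_stirling_nc \<alpha> (- c) (Suc m) k) =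
      (\<Sum>k\<le>Suc m. z k * (if k = 0 then 0 else gen_stirling_nc \<alpha> (- c) m (k - 1)))
      + (\<Sum>k\<le>Suc m. z k * ((real m - real k * \<alpha> + c) * gen_stirling_nc \<alpha> (- c) m k))"
    unfolding gen_stirling_nc_Suc distrib_left sum.distrib ..
  also have "(\<Sum>k\<le>Suc m. z k * (if k = 0 then 0 else gen_stirling_nc \<alpha> (- c) m (k - 1))) =
      (\<Sum>k\<le>m. z (Suc k) * gen_stirling_nc \<alpha> (- c) m k)"
    by (subst sum.atMost_Suc_shift) simp
  also have "(\<Sum>k\<le>Suc m. z k * ((real m - real k * \<alpha> + c) * gen_stirling_nc \<alpha> (- c) m k)) =
      (\<Sum>k\<le>m. z k * ((real m - real k * \<alpha> + c) * gen_stirling_nc \<alpha> (- c) m k))"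
    by (simp add: gen_stirling_nc_eq_0)
  finally show ?thesis by (simp add: sum.distrib[symmetric] algebra_simps)
qed

text \<open>
  The weight \<open>z\<close> of the number of blocks is arbitrary because the inductions on the elements and
  on the selected blocks replace it by other weights.
\<close>

lemma sum_extensions_block_weight:
  fixes z :: "nat \<Rightarrow> real"
  assumes N: "finite N" and P: "partition_on N P" and U: "finite U" "N \<inter> U = {}"
  shows "(\<Sum>Q\<in>extensions N P U. z (card Q) * block_weight \<alpha> Q) =
     block_weight \<alpha> P * (\<Sum>k\<le>card U. z (card P + k) *
       gen_stirling_nc \<alpha> (- (real (card N) - real (card P) * \<alpha>)) (card U) k)"
  using U
proof (induction U arbitrary: z rule: finite_induct)
  case empty
  then show ?case
    using P by (simp add: extensions_empty gen_stirling_nc_0_0)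
next
  case (insert x U)
  let ?c = "real (card N) - real (card P) * \<alpha>"
  let ?z = "\<lambda>c. z (Suc c) + (real (card N) + real (card U) - real c * \<alpha>) * z c"
  have NU: "N \<inter> U = {}" "x \<notin> N \<union> U" "card (N \<union> U) = card N + card U"
    using insert N by (auto simp: card_Un_disjoint)
  have "(\<Sum>Q\<in>extensions N P (insert x U). z (card Q) * block_weight \<alpha> Q) =
      (\<Sum>Q\<in>extensions N P U. ?z (card Q) * block_weight \<alpha> Q)"
    unfolding sum_extensions_insert[OF N insert.hyps(1) NU(2)]
  proof (rule sum.cong[OF refl])
    fix Q assume "Q \<in> extensions N P U"
    then show "(\<Sum>A\<in>insert {} Q. z (card (insert (insert x A) (Q - {A}))) *
        block_weight \<alpha> (insert (insert x A) (Q - {A}))) = ?z (card Q) * block_weight \<alpha> Q"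
      using sum_block_weight_add_element[of "N \<union> U" Q x z \<alpha>] N insert.hyps NU
      by (simp add: extensions_def mult.commute)
  qed
  also have "\<dots> = block_weight \<alpha> P *
      (\<Sum>k\<le>card U. ?z (card P + k) * gen_stirling_nc \<alpha> (- ?c) (card U) k)"
    by (rule insert.IH[OF NU(1)])
  \<comment> \<open>The \<open>card P\<close> old blocks contribute
    \<open>- card P * \<alpha>\<close>, which together with \<open>card N\<close> is
    \<open>?c\<close>.\<close>
  also have "(\<Sum>k\<le>card U. ?z (card P + k) * gen_stirling_nc \<alpha> (- ?c) (card U) k) =
      (\<Sum>k\<le>card U. (z (card P + Suc k) + (real (card U) - real k * \<alpha> + ?c) * z (card P + k)) *
         gen_stirling_nc \<alpha> (- ?c) (card U) k)"
    by (rule sum.cong) (simp_all add: algebra_simps)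
  also have "\<dots> = (\<Sum>k\<le>Suc (card U). z (card P + k) * gen_stirling_nc \<alpha> (- ?c) (Suc (card U)) k)"
    by (rule gen_stirling_nc_sum_Suc)
  finally show ?case using insert.hyps by simp
qed

section \<open>Factorial moments of the new-block counts\<close>

text \<open>The deterministic counterpart of \<open>new_blocks\<close>, for a fixed partition and a
  general ground set.\<close>

definition new_count :: "nat set \<Rightarrow> nat set set \<Rightarrow> nat \<Rightarrow> nat" where
  "new_count N Q l = card {B \<in> Q. B \<inter> N = {} \<and> card B = l}"

text \<open>Removing a new block of size \<open>l\<close> lowers that count by one and no other. All
  summands are therefore equal, and their number is the leading factor of the falling factorial at
  \<open>l\<close>.\<close>

lemma prod_falling_new_count:
  assumes "finite L" "l \<in> L" "r l = Suc p" "finite Q"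
  shows "(\<Prod>i\<in>L. falling (real (new_count N Q i)) (r i)) =
    (\<Sum>B\<in>{B \<in> Q. B \<inter> N = {} \<and> card B = l}.
       \<Prod>i\<in>L. falling (real (new_count N (Q - {B}) i)) ((r(l := p)) i))"
proof -
  let ?S = "{B \<in> Q. B \<inter> N = {} \<and> card B = l}"
  have "(\<Prod>i\<in>L. falling (real (new_count N (Q - {B}) i)) ((r(l := p)) i)) =
      falling (real (new_count N Q l) - 1) p *
        (\<Prod>i\<in>L - {l}. falling (real (new_count N Q i)) (r i))" if B: "B \<in> ?S" for B
  proof -
    have "{C \<in> Q - {B}. C \<inter> N = {} \<and> card C = l} = ?S - {B}" by auto
    then have "new_count N Q l = Suc (new_count N (Q - {B}) l)"
      using B assms by (simp add: new_count_def card_Suc_Diff1 del: card_Diff_insert)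
    moreover have "new_count N (Q - {B}) i = new_count N Q i" if "i \<noteq> l" for i
    proof -
      have "{C \<in> Q - {B}. C \<inter> N = {} \<and> card C = i} = {C \<in> Q. C \<inter> N = {} \<and> card C = i}"
        using that B by auto
      then show ?thesis by (simp add: new_count_def)
    qed
    ultimately show ?thesis
      using assms by (subst prod.remove[of _ l]) auto
  qed
  then have "(\<Sum>B\<in>?S. \<Prod>i\<in>L. falling (real (new_count N (Q - {B}) i)) ((r(l := p)) i)) =
      real (new_count N Q l) * (falling (real (new_count N Q l) - 1) p *
        (\<Prod>i\<in>L - {l}. falling (real (new_count N Q i)) (r i)))"
    by (simp add: new_count_def)
  then show ?thesis
    using assms by (subst prod.remove[of _ l]) (simp_all add: falling_Suc mult.assoc)
qed

text \<open>Induction on the number of selected blocks. Each step removes one block and passes to a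
  smaller \<open>U\<close> and a shifted \<open>z\<close>, hence both are generalized;
  \<open>0 \<notin> L\<close> keeps the removed block nonempty.\<close>

lemma sum_extensions_falling:
  fixes z :: "nat \<Rightarrow> real" and r :: "nat \<Rightarrow> nat"
  assumes N: "finite N" and P: "partition_on N P" and L: "finite L" "0 \<notin> L"
    and U: "finite U" "N \<inter> U = {}" "(\<Sum>l\<in>L. l * r l) \<le> card U"
  shows "(\<Sum>Q\<in>extensions N P U. z (card Q) * block_weight \<alpha> Q *
        (\<Prod>l\<in>L. falling (real (new_count N Q l)) (r l))) =
     fact (card U) / fact (card U - (\<Sum>l\<in>L. l * r l)) *
     (\<Prod>l\<in>L. (pochhammer (1 - \<alpha>) (l - 1) / fact l) ^ r l) * block_weight \<alpha> P *
     (\<Sum>k\<le>card U - (\<Sum>l\<in>L. l * r l). z (card P + (\<Sum>l\<in>L. r l) + k) *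
       gen_stirling_nc \<alpha> (- (real (card N) - real (card P) * \<alpha>))
         (card U - (\<Sum>l\<in>L. l * r l)) k)"
  using U
proof (induction "\<Sum>l\<in>L. r l" arbitrary: U r z)
  case 0
  then have "r l = 0" if "l \<in> L" for l using that L by simp
  then show ?case
    using sum_extensions_block_weight[OF N P 0(2,3), of z \<alpha>] by simp
next
  case (Suc R)
  have "\<exists>l\<in>L. r l \<noteq> 0"
    using Suc.hyps(2) by (rule contrapos_pp) simp
  then obtain l where l: "l \<in> L" "r l \<noteq> 0" by blast
  then obtain p where p: "r l = Suc p" by (auto simp: gr0_conv_Suc)
  have l1: "1 \<le> l" using l L by (cases l) auto
  let ?r = "r(l := p)"
  let ?M = "card U - (\<Sum>l\<in>L. l * r l)"
  let ?q = "\<lambda>i. pochhammer (1 - \<alpha>) (i - 1) / fact i"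
  let ?S = "\<Sum>k\<le>?M. z (card P + (\<Sum>l\<in>L. r l) + k) *
       gen_stirling_nc \<alpha> (- (real (card N) - real (card P) * \<alpha>)) ?M k"
  have sum_r: "(\<Sum>l\<in>L. r l) = Suc (\<Sum>l\<in>L. ?r l)"
    unfolding sum.remove[OF L(1) l(1)] using p by (simp cong: sum.cong_simp)
  have sum_lr: "(\<Sum>l\<in>L. l * r l) = l + (\<Sum>l\<in>L. l * ?r l)"
    unfolding sum.remove[OF L(1) l(1)] using p by (simp cong: sum.cong_simp)
  have prod_q: "(\<Prod>i\<in>L. ?q i ^ r i) = ?q l * (\<Prod>i\<in>L. ?q i ^ ?r i)"
    unfolding prod.remove[OF L(1) l(1)] using p by (simp cong: prod.cong_simp)
  have lU: "l \<le> card U" using Suc.prems(3) sum_lr by linarith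
  \<comment> \<open>The value depends on \<open>B\<close> only through its size, so summing over
    \<open>B\<close> merely adds a binomial coefficient.\<close>
  have inner: "(\<Sum>Q\<in>extensions N P (U - B). z (card (insert B Q)) * block_weight \<alpha> (insert B Q) *
        (\<Prod>i\<in>L. falling (real (new_count N (insert B Q - {B}) i)) (?r i))) =
      pochhammer (1 - \<alpha>) (l - 1) * (fact (card U - l) / fact ?M *
        (\<Prod>i\<in>L. ?q i ^ ?r i) * block_weight \<alpha> P * ?S)"
    if B: "B \<subseteq> U" "card B = l" for B
  proof -
    have UB: "finite (U - B)" "N \<inter> (U - B) = {}" "card (U - B) = card U - l"
      using Suc.prems B by (auto simp: card_Diff_subset finite_subset)
    have M: "card (U - B) - (\<Sum>l\<in>L. l * ?r l) = ?M" unfolding UB sum_lr by simp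
    have "(\<Sum>Q\<in>extensions N P (U - B). z (card (insert B Q)) * block_weight \<alpha> (insert B Q) *
        (\<Prod>i\<in>L. falling (real (new_count N (insert B Q - {B}) i)) (?r i))) =
      (\<Sum>Q\<in>extensions N P (U - B). pochhammer (1 - \<alpha>) (l - 1) * (z (Suc (card Q)) * block_weight \<alpha> Q *
        (\<Prod>i\<in>L. falling (real (new_count N Q i)) (?r i))))"
    proof (rule sum.cong[OF refl])
      fix Q assume Q: "Q \<in> extensions N P (U - B)"
      have "B \<noteq> {}" using B l1 by auto
      then have "B \<notin> Q" "finite Q"
        using extensions_insert_block[of B U N Q P] B(1) Suc.prems(2) Q
          finite_extension[OF N UB(1) Q] by auto
      then show "z (card (insert B Q)) * block_weight \<alpha> (insert B Q) *
          (\<Prod>i\<in>L. falling (real (new_count N (insert B Q - {B}) i)) (?r i)) =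
        pochhammer (1 - \<alpha>) (l - 1) * (z (Suc (card Q)) * block_weight \<alpha> Q *
          (\<Prod>i\<in>L. falling (real (new_count N Q i)) (?r i)))"
        using B by (simp add: block_weight_insert)
    qed
    also have "\<dots> = pochhammer (1 - \<alpha>) (l - 1) * (\<Sum>Q\<in>extensions N P (U - B).
        z (Suc (card Q)) * block_weight \<alpha> Q * (\<Prod>i\<in>L. falling (real (new_count N Q i)) (?r i)))"
      by (rule sum_distrib_left[symmetric])
    \<comment> \<open>The induction hypothesis is used at the weight
      \<open>\<lambda>c. z (Suc c)\<close>, since \<open>B\<close> counts as one block.\<close>
    also have "(\<Sum>Q\<in>extensions N P (U - B).
        z (Suc (card Q)) * block_weight \<alpha> Q * (\<Prod>i\<in>L. falling (real (new_count N Q i)) (?r i))) =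
        fact (card U - l) / fact ?M * (\<Prod>i\<in>L. ?q i ^ ?r i) * block_weight \<alpha> P * ?S"
    proof -
      have "R = (\<Sum>l\<in>L. ?r l)" using Suc.hyps(2) sum_r by simp
      moreover have "(\<Sum>l\<in>L. l * ?r l) \<le> card (U - B)"
        using Suc.prems(3) UB(3) sum_lr by simp
      ultimately show ?thesis
        using Suc.hyps(1)[of ?r "U - B" "\<lambda>c. z (Suc c)"] UB(1,2) unfolding M unfolding UB(3) sum_r
        by simp
    qed
    finally show ?thesis .
  qed
  have "(\<Sum>Q\<in>extensions N P U. z (card Q) * block_weight \<alpha> Q *
        (\<Prod>l\<in>L. falling (real (new_count N Q l)) (r l))) =
      (\<Sum>Q\<in>extensions N P U. \<Sum>B\<in>{B \<in> Q. B \<inter> N = {} \<and> card B = l}.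
        z (card Q) * block_weight \<alpha> Q *
        (\<Prod>i\<in>L. falling (real (new_count N (Q - {B}) i)) (?r i)))"
    using prod_falling_new_count[of L l r p _ N] L l p finite_extension[OF N Suc.prems(1)]
    by (intro sum.cong) (simp_all only: sum_distrib_left)
  also have "\<dots> = (\<Sum>B\<in>{B. B \<subseteq> U \<and> card B = l}.
      \<Sum>Q\<in>extensions N P (U - B). z (card (insert B Q)) * block_weight \<alpha> (insert B Q) *
        (\<Prod>i\<in>L. falling (real (new_count N (insert B Q - {B}) i)) (?r i)))"
    by (rule sum_extensions_new_blocks[OF N Suc.prems(1,2) l1])
  also have "\<dots> = real (card U choose l) * (pochhammer (1 - \<alpha>) (l - 1) *
      (fact (card U - l) / fact ?M * (\<Prod>i\<in>L. ?q i ^ ?r i) * block_weight \<alpha> P * ?S))"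
    using inner Suc.prems(1) by (simp add: n_subsets)
  also have "\<dots> = fact (card U) / fact ?M * (?q l * (\<Prod>i\<in>L. ?q i ^ ?r i)) * block_weight \<alpha> P * ?S"
  \<comment> \<open>The binomial coefficient cancels \<open>fact (card U - l)\<close>, and its
    remaining \<open>1 / fact l\<close> completes the factor \<open>?q l\<close>.\<close>
  proof -
    have "real (card U choose l) * (x * (fact (card U - l) / y * a * b * s)) =
        fact (card U) / y * ((x / fact l) * a) * b * s" for x y a b s :: real
      using lU by (simp add: binomial_fact mult_ac)
    then show ?thesis .
  qed
  finally show ?case unfolding prod_q .
qed

section \<open>Conditional expectations and the moment formula\<close>

text \<open>The restriction to \<open>{1..N}\<close> takes finitely many values, so the integrand is
  a finite combination of indicators.\<close>

lemma (in random_partition) cond_expectation_restriction_event: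
  assumes P: "partition_on {1..n} P" and pos: "0 < prob (restriction_event M X n P)"
    and le: "n \<le> N"
  shows "cond_expectation M (restriction_event M X n P)
      (\<lambda>\<omega>. g (restrict_partition (X \<omega>) {1..N})) =
    (\<Sum>Q\<in>extensions {1..n} P {n<..N}. g Q * prob (restriction_event M X N Q))
      / prob (restriction_event M X n P)"
proof -
  let ?E = "restriction_event M X n P" and ?F = "restriction_event M X N"
  let ?U = "uniform_measure M ?E"
  let ?\<Q> = "{Q. partition_on {1..N} Q}"
  have fin: "finite ?\<Q>" by (rule finitely_many_partition_on) simp
  have E: "emeasure M ?E \<noteq> 0" "emeasure M ?E \<noteq> \<infinity>"
    using pos by (auto simp: emeasure_eq_measure)
  interpret U: prob_space ?U using E by (rule prob_space_uniform_measure)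
  have F: "?F Q \<in> sets M" if "Q \<in> ?\<Q>" for Q
    using measurable_restriction that by simp
  have "g (restrict_partition (X \<omega>) {1..N}) = (\<Sum>Q\<in>?\<Q>. indicator (?F Q) \<omega> * g Q)"
    if "\<omega> \<in> space M" for \<omega>
  proof -
    have "restrict_partition (X \<omega>) {1..N} \<in> ?\<Q>"
      using partition_on_restrict_partition[OF partition[OF that], of "{1..N}"] by auto
    moreover have "(\<Sum>Q\<in>?\<Q>. indicator (?F Q) \<omega> * g Q) =
        (\<Sum>Q\<in>?\<Q>. if Q = restrict_partition (X \<omega>) {1..N} then g Q else 0)"
      using that by (intro sum.cong) (auto simp: restriction_event_def)
    ultimately show ?thesis using fin by simp
  qed
  then have "cond_expectation M ?E (\<lambda>\<omega>. g (restrict_partition (X \<omega>) {1..N})) =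
      (\<integral>\<omega>. (\<Sum>Q\<in>?\<Q>. indicator (?F Q) \<omega> * g Q) \<partial>?U)"
    unfolding cond_expectation_def by (intro Bochner_Integration.integral_cong) simp_all
  also have "\<dots> = (\<Sum>Q\<in>?\<Q>. \<integral>\<omega>. indicator (?F Q) \<omega> * g Q \<partial>?U)"
    using F by (intro Bochner_Integration.integral_sum) (simp add: U.emeasure_eq_measure)
  also have "\<dots> = (\<Sum>Q\<in>?\<Q>. (prob (?E \<inter> ?F Q) / prob ?E) * g Q)"
    using F E by (intro sum.cong) (simp_all add: measure_uniform_measure)
  \<comment> \<open>The restriction to \<open>{1..N}\<close> determines the one to
    \<open>{1..n}\<close>. So the event of \<open>Q\<close> lies inside the conditioning event if
    \<open>Q\<close> extends \<open>P\<close>, and is disjoint from it otherwise.\<close>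
  also have "\<dots> = (\<Sum>Q\<in>extensions {1..n} P {n<..N}. (prob (?F Q) / prob ?E) * g Q)"
  proof (rule sum.mono_neutral_cong_right[OF fin])
    have N: "{1..n} \<union> {n<..N} = {1..N}" using le by auto
    have restr: "restrict_partition (restrict_partition Q {1..N}) {1..n} = restrict_partition Q {1..n}"
      for Q by (rule restrict_partition_restrict_partition) (use le in auto)
    show "extensions {1..n} P {n<..N} \<subseteq> ?\<Q>"
      unfolding extensions_def N by blast
    show "\<forall>Q\<in>?\<Q> - extensions {1..n} P {n<..N}. prob (?E \<inter> ?F Q) / prob ?E * g Q = 0"
    proof
      fix Q assume "Q \<in> ?\<Q> - extensions {1..n} P {n<..N}"
      then have "?E \<inter> ?F Q = {}"
        using restr unfolding extensions_def restriction_event_def N by auto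
      then show "prob (?E \<inter> ?F Q) / prob ?E * g Q = 0" by simp
    qed
    show "prob (?E \<inter> ?F Q) / prob ?E * g Q = prob (?F Q) / prob ?E * g Q"
      if "Q \<in> extensions {1..n} P {n<..N}" for Q
    proof -
      have "?E \<inter> ?F Q = ?F Q"
        using restr that unfolding extensions_def restriction_event_def by auto
      then show ?thesis by simp
    qed
  qed
  finally show ?thesis by (simp add: sum_divide_distrib mult.commute)
qed

text \<open>The enumeration is applied with \<open>z = V (n + m)\<close>. Dividing by the
  probability of the conditioning event cancels \<open>block_weight \<alpha> P\<close> and leaves
  \<open>1 / V n (card P)\<close>.\<close>

lemma (in gibbs_partition) cond_expectation_falling_new_blocks:
  assumes n: "1 \<le> n" and P: "partition_on {1..n} P" and V: "0 < V n (card P)"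
    and r: "(\<Sum>l=1..m. l * r l) \<le> m"
  shows "cond_expectation M (restriction_event M X n P)
        (\<lambda>\<omega>. \<Prod>l=1..m. falling (real (new_blocks X n m l \<omega>)) (r l)) =
      (fact m * (\<Prod>l=1..m. pochhammer (1 - \<alpha>) (l - 1) ^ r l)) /
      (fact (m - (\<Sum>l=1..m. l * r l)) * (\<Prod>l=1..m. (fact l) ^ r l)) * (1 / V n (card P)) *
      (\<Sum>k = (\<Sum>l=1..m. r l)..(\<Sum>l=1..m. r l) + (m - (\<Sum>l=1..m. l * r l)).
         V (n + m) (card P + k) *
         gen_stirling_nc \<alpha> (- (real n - real (card P) * \<alpha>))
           (m - (\<Sum>l=1..m. l * r l)) (k - (\<Sum>l=1..m. r l)))"
proof -
  let ?E = "restriction_event M X n P"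
  let ?R = "\<Sum>l=1..m. r l" and ?M = "m - (\<Sum>l=1..m. l * r l)"
  let ?S = "\<lambda>k. gen_stirling_nc \<alpha> (- (real n - real (card P) * \<alpha>)) ?M k"
  let ?g = "\<lambda>Q. \<Prod>l=1..m. falling (real (new_count {1..n} Q l)) (r l)"
  \<comment> \<open>Positivity of \<open>1 - \<alpha>\<close> makes the conditioning event have
    positive probability, as \<open>uniform_measure\<close> requires.\<close>
  have "0 < block_weight \<alpha> P"
    unfolding block_weight_def using alpha_less_1 by (intro prod_pos pochhammer_pos ballI) simp
  moreover have pE: "prob ?E = V n (card P) * block_weight \<alpha> P"
    using prob_restriction[OF n P] by (simp add: block_weight_def)
  ultimately have pos: "0 < prob ?E" and w: "block_weight \<alpha> P \<noteq> 0"
    using V by simp_all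
  have N: "{1..n} \<union> {n<..n + m} = {1..n + m}" by auto
  have "cond_expectation M ?E (\<lambda>\<omega>. \<Prod>l=1..m. falling (real (new_blocks X n m l \<omega>)) (r l)) =
      cond_expectation M ?E (\<lambda>\<omega>. ?g (restrict_partition (X \<omega>) {1..n + m}))"
    by (simp add: new_blocks_def new_count_def)
  also have "\<dots> = (\<Sum>Q\<in>extensions {1..n} P {n<..n + m}.
      ?g Q * prob (restriction_event M X (n + m) Q)) / prob ?E"
    by (rule cond_expectation_restriction_event[OF P pos]) simp
  also have "(\<Sum>Q\<in>extensions {1..n} P {n<..n + m}.
        ?g Q * prob (restriction_event M X (n + m) Q)) =
      (\<Sum>Q\<in>extensions {1..n} P {n<..n + m}. V (n + m) (card Q) * block_weight \<alpha> Q * ?g Q)"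
  proof (rule sum.cong[OF refl])
    fix Q assume "Q \<in> extensions {1..n} P {n<..n + m}"
    then have "partition_on {1..n + m} Q" unfolding extensions_def N by blast
    then show "?g Q * prob (restriction_event M X (n + m) Q) =
        V (n + m) (card Q) * block_weight \<alpha> Q * ?g Q"
      using prob_restriction[of "n + m" Q] n by (simp add: block_weight_def)
  qed
  also have "\<dots> = fact m / fact ?M *
      (\<Prod>l=1..m. (pochhammer (1 - \<alpha>) (l - 1) / fact l) ^ r l) * block_weight \<alpha> P *
      (\<Sum>k\<le>?M. V (n + m) (card P + ?R + k) * ?S k)"
    using sum_extensions_falling[of "{1..n}" P "{1..m}" "{n<..n + m}" r "V (n + m)" \<alpha>] P r
    by (auto simp: disjoint_iff)
  also have "(\<Sum>k\<le>?M. V (n + m) (card P + ?R + k) * ?S k) =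
      (\<Sum>k = ?R..?R + ?M. V (n + m) (card P + k) * ?S (k - ?R))"
    by (rule sum.reindex_bij_witness[where i = "\<lambda>k. k - ?R" and j = "\<lambda>k. k + ?R"])
       (auto simp: add_ac)
  finally show ?thesis
    unfolding pE using w by (simp add: power_divide prod_dividef)
qed

theorem proposition7:
  fixes M :: "'w measure" and X :: "'w \<Rightarrow> nat set set"
    and \<alpha> :: real and V :: "nat \<Rightarrow> nat \<Rightarrow> real"
    and n m j :: nat and P :: "nat set set"
  assumes gibbs: "gibbs_partition M X \<alpha> V"
    and n: "1 \<le> n" and m: "1 \<le> m"
    and P: "partition_on {1..n} P" and j: "card P = j"
    and V: "0 < V n j"
  shows "(\<forall>r :: nat \<Rightarrow> nat. (\<Sum>l=1..m. l * r l) \<le> m \<longrightarrow>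
      cond_expectation M (restriction_event M X n P)
        (\<lambda>\<omega>. \<Prod>l=1..m. falling (real (new_blocks X n m l \<omega>)) (r l)) =
      (fact m * (\<Prod>l=1..m. pochhammer (1 - \<alpha>) (l - 1) ^ r l)) /
      (fact (m - (\<Sum>l=1..m. l * r l)) * (\<Prod>l=1..m. (fact l) ^ r l)) * (1 / V n j) *
      (\<Sum>k = (\<Sum>l=1..m. r l)..(\<Sum>l=1..m. r l) + (m - (\<Sum>l=1..m. l * r l)).
         V (n + m) (j + k) *
         gen_stirling_nc \<alpha> (- (real n - real j * \<alpha>))
           (m - (\<Sum>l=1..m. l * r l)) (k - (\<Sum>l=1..m. r l))))
    \<and>
    (\<forall>l\<in>{1..m}. \<forall>r::nat. r \<le> m div l \<longrightarrow>
      cond_expectation M (restriction_event M X n P)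
        (\<lambda>\<omega>. falling (real (new_blocks X n m l \<omega>)) r) =
      fact m / fact (m - r * l) * (pochhammer (1 - \<alpha>) (l - 1) ^ r / (fact l) ^ r) *
      (1 / V n j) *
      (\<Sum>k = r..r + (m - r * l).
         V (n + m) (j + k) *
         gen_stirling_nc \<alpha> (- (real n - real j * \<alpha>)) (m - r * l) (k - r)))"
    (is "(\<forall>r. _ r \<longrightarrow> ?E r = ?rhs r) \<and> _")
proof (intro conjI allI impI ballI)
  interpret gibbs_partition M X \<alpha> V by (rule gibbs)
  show moments: "?E r = ?rhs r" if "(\<Sum>l=1..m. l * r l) \<le> m" for r
    using cond_expectation_falling_new_blocks[OF n P _ that] V j by simp
  fix l r assume l: "l \<in> {1..m}" and r: "r \<le> m div l"
  \<comment> \<open>The single-size formula is the joint one with all selections of size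
    \<open>l\<close>; every other factor has exponent 0 and equals 1.\<close>
  let ?r = "\<lambda>i. if i = l then r else 0"
  have delta: "(\<Prod>i=1..m. f i (?r i)) = f l r" if "\<And>i. f i 0 = 1" for f :: "nat \<Rightarrow> nat \<Rightarrow> real"
    using l that by (subst prod.remove[of _ l]) simp_all
  have sums: "(\<Sum>i=1..m. i * ?r i) = r * l" "(\<Sum>i=1..m. ?r i) = r"
    using l by (simp_all add: if_distrib[of "(*) _"] cong: if_cong)
  have "r * l \<le> m" using l r by (simp add: less_eq_div_iff_mult_less_eq)
  then show "cond_expectation M (restriction_event M X n P)
        (\<lambda>\<omega>. falling (real (new_blocks X n m l \<omega>)) r) =
      fact m / fact (m - r * l) * (pochhammer (1 - \<alpha>) (l - 1) ^ r / (fact l) ^ r) *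
      (1 / V n j) *
      (\<Sum>k = r..r + (m - r * l).
         V (n + m) (j + k) *
         gen_stirling_nc \<alpha> (- (real n - real j * \<alpha>)) (m - r * l) (k - r))"
    using moments[of ?r] unfolding sums
    using delta[of "\<lambda>i. falling (real (new_blocks X n m i \<omega>))" for \<omega>]
      delta[of "\<lambda>i k. pochhammer (1 - \<alpha>) (i - 1) ^ k"] delta[of "\<lambda>i k. fact i ^ k"]
    by simp
qed

end
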